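(* Let $m\geqslant 4$, $k$, $s_{m-2},s_{m-1},s_m$ be positive integers with $2\leqslant s_{m-2}\leqslant s_{m-1}\leqslant s_m$, and put $s_1=s_2=\dots=s_{m-3}=1$ and $\delta=\sum_{j=1}^m s_j=m-3+s_{m-2}+s_{m-1}+s_m$, and assume $\delta\leqslant k$. Consider the $\delta\times k$ matrices over $\mathbb{F}_2$ consisting of $m$ vertically stacked blocks, where for each $i\in\{1,\dots,m\}$ the $i$-th block has $s_i$ rows and its $r$-th row ($1\leqslant r\leqslant s_i$) is $(\alpha^{(i)}_r,\alpha^{(i)}_{r+1},\dots,\alpha^{(i)}_{r+k-1})$, with free parameters $\alpha^{(i)}_j\in\mathbb{F}_2$ for $1\leqslant j\leqslant s_i+k-1$. (Thus the first $m-3$ blocks are single arbitrary rows, and the last three blocks are persymmetric/Hankel $s_i\times k$ matrices.) Then the number of choices of the parameters $(\alpha^{(i)}_j)$ for which such a matrix has rank $\delta$ equals $$2^{\delta-m}\prod_{j=1}^{m}\left(2^{k}-2^{\delta-j}\right).$$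
   Context: Matrices of the described form are called $m$-times persymmetric matrices over the field $\mathbb{F}_2$ with two elements. The count is the number of parameter tuples $(\alpha^{(i)}_j)_{1\le i\le m,\,1\le j\le s_i+k-1}\in\mathbb{F}_2^{\sum_i (s_i+k-1)}$ giving a matrix of full row rank $\delta$. *)

theory Defs
  imports "HOL-Library.FuncSet" "HOL-Library.Z2" "Jordan_Normal_Form.DL_Rank"
begin

text \<open>The \<open>m\<close>-times persymmetric matrix over the two-element field. Blocks \<open>i\<close>, the rows \<open>r\<close> of a
  block and the parameters \<open>\<alpha> i j\<close> are counted from 1; the column index \<open>c\<close> is counted from 0, as for
  all vectors of this library, so that row \<open>r\<close> of block \<open>i\<close> is
  \<open>(\<alpha> i r, \<alpha> i (r + 1), \<dots>, \<alpha> i (r + k - 1))\<close>.\<close>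

definition persymmetric_mat :: "nat \<Rightarrow> (nat \<Rightarrow> nat) \<Rightarrow> nat \<Rightarrow> (nat \<Rightarrow> nat \<Rightarrow> bit) \<Rightarrow> bit mat" where
  "persymmetric_mat m s k \<alpha> =
     mat_of_rows k
       (concat (map (\<lambda>i. map (\<lambda>r. vec k (\<lambda>c. \<alpha> i (r + c))) [1..<s i + 1]) [1..<m + 1]))"

definition persymmetric_params :: "nat \<Rightarrow> (nat \<Rightarrow> nat) \<Rightarrow> nat \<Rightarrow> (nat \<Rightarrow> nat \<Rightarrow> bit) set" where
  "persymmetric_params m s k = (\<Pi>\<^sub>E i\<in>{1..m}. {1..s i + k - 1} \<rightarrow>\<^sub>E UNIV)"

end

theory Submission
  imports Defs "HOL-Computational_Algebra.Primes"
begin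

text \<open>
  A linear relation between the rows is a tuple \<open>p\<close> of polynomials with \<open>deg p\<^sub>i < s i\<close>. For a set \<open>S\<close> of such tuples let \<open>W\<^sub>k\<close> be the space of
  combinations of \<open>S\<close> with polynomial coefficients of degree below \<open>k\<close>; by duality the parameters for
  which all of \<open>S\<close> are row relations number \<open>2 ^ (D + m k - dim W\<^sub>k)\<close>, where \<open>D = \<delta> - m\<close>.

  The sequence \<open>dim W\<^sub>k\<close> is concave, because \<open>W\<^sub>k\<^sub>+\<^sub>2 = W\<^sub>k\<^sub>+\<^sub>1 + x W\<^sub>k\<^sub>+\<^sub>1\<close> and \<open>x W\<^sub>k\<close> lies in the
  intersection of the two summands. If \<open>\<rho>\<close> is the size of a minimal set of coordinates that separates
  the points of the module generated by \<open>S\<close>, then \<open>\<rho> (k - c) \<le> dim W\<^sub>k \<le> \<rho> k + D\<close>. Concavity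
  upgrades these bounds to \<open>dim W\<^sub>k\<^sub>+\<^sub>1 = dim W\<^sub>k + \<rho>\<close> as soon as \<open>k \<ge> D\<close>.

  By inclusion-exclusion over \<open>S\<close>, the number of full rank matrices is therefore, for all \<open>k \<ge> D\<close>, the
  value at \<open>2 ^ k\<close> of a single polynomial of degree \<open>m\<close> with leading coefficient \<open>2 ^ D\<close>. A matrix with
  \<open>k < \<delta>\<close> columns does not have rank \<open>\<delta>\<close>, so \<open>2 ^ D, \<dots>, 2 ^ (\<delta> - 1)\<close> are its \<open>m\<close> roots.
\<close>

text \<open>Unqualified, the name would refer to the record field of HOL-Algebra modules.\<close>

abbreviation smult :: "'a :: comm_semiring_0 \<Rightarrow> 'a poly \<Rightarrow> 'a poly" where
  "smult \<equiv> Polynomial.smult"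

section \<open>Signs on the two-element field and elementary counting\<close>

lemma finite_UNIV_bit: "finite (UNIV :: bit set)" and card_UNIV_bit: "card (UNIV :: bit set) = 2"
proof -
  have eq: "(UNIV :: bit set) = {0, 1}"
    by (auto intro: bit.exhaust)
  show "finite (UNIV :: bit set)" "card (UNIV :: bit set) = 2"
    by (simp_all add: eq)
qed

lemma bit_add_self: "(a :: bit) + a = 0"
  by (cases a) simp_all

text \<open>The nontrivial additive character of the two-element field. Its values are integers, so
  that sums of signs can cancel.\<close>

definition bit_sign :: "bit \<Rightarrow> int" where
  "bit_sign a = (if a = 0 then 1 else -1)"

lemma bit_sign_simps [simp]: "bit_sign 0 = 1" "bit_sign (a + 1) = - bit_sign a"
  by (cases a; simp add: bit_sign_def)+

lemma sum_bit_sign_eq_0: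
  assumes "bij_betw g A A" "\<And>x. x \<in> A \<Longrightarrow> f (g x) = f x + 1"
  shows "(\<Sum>x\<in>A. bit_sign (f x)) = 0"
proof -
  have "(\<Sum>x\<in>A. bit_sign (f x)) = (\<Sum>x\<in>A. bit_sign (f (g x)))"
    using sum.reindex_bij_betw[OF assms(1), of "\<lambda>x. bit_sign (f x)"] by simp
  also have "\<dots> = (\<Sum>x\<in>A. - bit_sign (f x))"
    by (rule sum.cong) (simp_all only: assms(2) bit_sign_simps)
  also have "\<dots> = - (\<Sum>x\<in>A. bit_sign (f x))"
    by (rule sum_negf)
  finally show ?thesis by simp
qed

text \<open>Sum the signs of \<open>e w \<alpha>\<close> over \<open>W \<times> \<Omega>\<close> in both orders; \<open>flip\<close> and \<open>shift\<close> provide the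
  bijections that cancel the nontrivial inner sums.\<close>

lemma card_mult_card_annihilator:
  fixes e :: "'a \<Rightarrow> 'b \<Rightarrow> bit"
  assumes fin: "finite W" "finite \<Omega>"
    and z: "z \<in> W" "\<And>\<alpha>. \<alpha> \<in> \<Omega> \<Longrightarrow> e z \<alpha> = 0"
    and flip: "\<And>w. w \<in> W \<Longrightarrow> w \<noteq> z \<Longrightarrow> \<exists>g. bij_betw g \<Omega> \<Omega> \<and> (\<forall>\<alpha>\<in>\<Omega>. e w (g \<alpha>) = e w \<alpha> + 1)"
    and shift: "\<And>\<alpha> v. \<alpha> \<in> \<Omega> \<Longrightarrow> v \<in> W \<Longrightarrow> e v \<alpha> = 1 \<Longrightarrow>
                  \<exists>g. bij_betw g W W \<and> (\<forall>w\<in>W. e (g w) \<alpha> = e w \<alpha> + 1)"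
  shows "card W * card {\<alpha>\<in>\<Omega>. \<forall>w\<in>W. e w \<alpha> = 0} = card \<Omega>"
proof -
  have W: "(\<Sum>w\<in>W. bit_sign (e w \<alpha>)) = (if \<forall>w\<in>W. e w \<alpha> = 0 then int (card W) else 0)"
    if "\<alpha> \<in> \<Omega>" for \<alpha>
  proof (cases "\<forall>w\<in>W. e w \<alpha> = 0")
    case False
    then obtain v where "v \<in> W" "e v \<alpha> = 1" by auto
    from shift[OF that this] show ?thesis
      using False sum_bit_sign_eq_0[of _ W "\<lambda>w. e w \<alpha>"] by auto
  qed auto
  have \<Omega>: "(\<Sum>\<alpha>\<in>\<Omega>. bit_sign (e w \<alpha>)) = (if w = z then int (card \<Omega>) else 0)" if "w \<in> W" for w
    using flip[OF that] sum_bit_sign_eq_0[of _ \<Omega> "e w"] by (auto simp: z)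
  have "int (card W * card {\<alpha>\<in>\<Omega>. \<forall>w\<in>W. e w \<alpha> = 0}) = (\<Sum>\<alpha>\<in>\<Omega>. \<Sum>w\<in>W. bit_sign (e w \<alpha>))"
    using fin by (simp add: W sum.If_cases Int_def)
  also have "\<dots> = (\<Sum>w\<in>W. \<Sum>\<alpha>\<in>\<Omega>. bit_sign (e w \<alpha>))"
    by (rule sum.swap)
  also have "\<dots> = int (card \<Omega>)"
    using fin z(1) by (simp add: \<Omega>)
  finally show ?thesis by linarith
qed

text \<open>Every fibre of the addition map on \<open>A \<times> B\<close> is a translate of
  \<open>A \<inter> B\<close>, by way of \<open>(a + d, b - d)\<close>. This plays the part of the
  dimension formula for the sum of two subspaces.\<close>

lemma card_sum_Int_subgroups:
  fixes A B :: "'a :: ab_group_add set"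
  assumes fin: "finite A" "finite B"
    and A: "\<And>x y. x \<in> A \<Longrightarrow> y \<in> A \<Longrightarrow> x - y \<in> A" and B: "\<And>x y. x \<in> B \<Longrightarrow> y \<in> B \<Longrightarrow> x - y \<in> B"
  shows "card ((\<lambda>(a, b). a + b) ` (A \<times> B)) * card (A \<inter> B) = card A * card B"
proof -
  let ?f = "\<lambda>(a, b). a + b"
  have fibre: "card {p \<in> A \<times> B. ?f p = y} = card (A \<inter> B)" if "y \<in> ?f ` (A \<times> B)" for y
  proof -
    from that obtain a b where ab: "a \<in> A" "b \<in> B" "y = a + b" by auto
    \<comment> \<open>Closure under subtraction yields \<open>0 = y - y\<close>, then
      \<open>0 - y\<close>, then \<open>x - (0 - y)\<close>.\<close>
    have A': "x + y \<in> A" if "x \<in> A" "y \<in> A" for x y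
      using A[OF that(1) A[OF A[OF that(2,2)] that(2)]] by simp
    have "bij_betw (\<lambda>d. (a + d, b - d)) (A \<inter> B) {p \<in> A \<times> B. ?f p = y}"
    proof (rule bij_betw_byWitness[where f' = "\<lambda>p. fst p - a"])
      show "(\<lambda>p. fst p - a) ` {p \<in> A \<times> B. ?f p = y} \<subseteq> A \<inter> B"
      proof (rule image_subsetI)
        fix p assume "p \<in> {p \<in> A \<times> B. ?f p = y}"
        then obtain a' b' where p: "p = (a', b')" "a' \<in> A" "b' \<in> B" "a' + b' = a + b"
          using ab by auto
        have "a' = a + b - b'" using p(4) by (simp only: eq_diff_eq)
        hence "a' - a = b - b'" by simp
        with A[OF p(2) ab(1)] B[OF ab(2) p(3)] p(1) show "fst p - a \<in> A \<inter> B" by simp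
      qed
      show "(\<lambda>d. (a + d, b - d)) ` (A \<inter> B) \<subseteq> {p \<in> A \<times> B. ?f p = y}"
        using ab A' B by auto
      show "\<forall>p\<in>{p \<in> A \<times> B. ?f p = y}. (a + (fst p - a), b - (fst p - a)) = p"
      proof
        fix p assume "p \<in> {p \<in> A \<times> B. ?f p = y}"
        hence "snd p = y - fst p" by auto
        thus "(a + (fst p - a), b - (fst p - a)) = p" by (simp add: prod_eq_iff ab(3))
      qed
    qed simp
    from bij_betw_same_card[OF this] show ?thesis by simp
  qed
  have "card (A \<times> B) = (\<Sum>y\<in>?f ` (A \<times> B). card {p \<in> A \<times> B. ?f p = y})"
    using fin sum.image_gen[of "A \<times> B" "\<lambda>_. 1 :: nat" ?f] by simp
  also have "\<dots> = (\<Sum>y\<in>?f ` (A \<times> B). card (A \<inter> B))"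
    by (rule sum.cong) (simp_all only: fibre)
  finally show ?thesis by (simp add: card_cartesian_product)
qed

text \<open>Concavity makes the increments nonincreasing. If increment \<open>n\<close> were below
  \<open>\<rho>\<close>, all later ones would be too, and \<open>d\<close> would eventually fall
  under the lower bound. If it exceeded \<open>\<rho>\<close>, so would all earlier ones, giving
  \<open>d (n + 1) \<ge> (n + 1) * (\<rho> + 1)\<close>, which beats the upper bound once
  \<open>n \<ge> D\<close>.\<close>

lemma increments_eq_slope:
  fixes d :: "nat \<Rightarrow> nat"
  assumes d0: "d 0 = 0"
    and concave: "\<And>n. d (n + 2) + d n \<le> 2 * d (n + 1)"
    and upper: "\<And>n. d n \<le> \<rho> * n + D"
    and lower: "\<And>n. \<rho> * n \<le> d (n + c)"
    and "n \<ge> D"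
  shows "d (n + 1) = d n + \<rho>"
proof -
  define a :: "nat \<Rightarrow> int" where "a n = int (d (n + 1)) - int (d n)" for n
  have dec: "a j \<le> a i" if "i \<le> j" for i j
    using that
  proof (induction rule: dec_induct)
    case (step j)
    thus ?case using concave[of j] by (simp add: a_def)
  qed auto
  have tel: "int (d (n + j)) = int (d n) + (\<Sum>i<j. a (n + i))" for n j
    by (induction j) (simp_all add: a_def)
  have "a n \<ge> int \<rho>"
  proof (rule ccontr)
    assume "\<not> a n \<ge> int \<rho>"
    hence le: "a (n + i) \<le> int \<rho> - 1" for i using dec[of n "n + i"] by auto
    \<comment> \<open>Each step loses at least 1 against slope \<open>\<rho>\<close>. So many steps
      use up both the head start \<open>d n\<close> and the slack \<open>\<rho> * c\<close> coming
      from the shift in the lower bound.\<close>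
    define j where "j = d n + \<rho> * c + 1"
    have "(\<Sum>i<j+c. a (n + i)) \<le> (\<Sum>i<j+c. int \<rho> - 1)"
      by (intro sum_mono le)
    with tel[of n "j + c"] lower[of "n + j"]
    have "int \<rho> * int (n + j) \<le> int (d n) + int (j + c) * (int \<rho> - 1)"
      by (simp add: algebra_simps flip: of_nat_mult of_nat_add)
    hence "1 + (int c + int \<rho> * int n) \<le> 0" by (simp add: j_def algebra_simps)
    moreover have "int \<rho> * int n \<ge> 0" by simp
    ultimately show False by linarith
  qed
  moreover have "a n \<le> int \<rho>"
  proof (rule ccontr)
    assume "\<not> a n \<le> int \<rho>"
    hence ge: "a i \<ge> int \<rho> + 1" if "i < n + 1" for i using dec[of i n] that by auto
    have "(\<Sum>i<n+1. int \<rho> + 1) \<le> (\<Sum>i<n+1. a i)"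
      by (intro sum_mono ge) auto
    with tel[of 0 "n + 1"] d0
    have "int (d (n + 1)) \<ge> int (n + 1) * (int \<rho> + 1)" by simp
    moreover have "int (d (n + 1)) \<le> int \<rho> * int (n + 1) + int D"
      using of_nat_mono[OF upper[of "n + 1"], where 'a = int] by (simp only: of_nat_add of_nat_mult)
    ultimately show False using \<open>n \<ge> D\<close> by (simp add: algebra_simps)
  qed
  ultimately show ?thesis by (simp add: a_def)
qed

text \<open>The difference of the two sides vanishes on \<open>R\<close>, has degree at most
  \<open>card R\<close> and has coefficient 0 there, so it has too many roots unless it is
  zero.\<close>

lemma poly_eq_prod_of_roots:
  fixes Q :: "int poly"
  assumes deg: "degree Q \<le> card R" and fin: "finite R" and roots: "\<And>x. x \<in> R \<Longrightarrow> poly Q x = 0"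
  shows "Q = smult (coeff Q (card R)) (\<Prod>x\<in>R. [:- x, 1:])"
proof (rule ccontr)
  let ?P = "\<Prod>x\<in>R. [:- x, 1:]"
  let ?H = "Q - smult (coeff Q (card R)) ?P"
  assume "Q \<noteq> smult (coeff Q (card R)) ?P"
  hence H: "?H \<noteq> 0" by simp
  have degP: "degree ?P = card R"
    using fin by (induction R rule: finite_induct) (simp_all add: degree_mult_eq del: mult_pCons_left)
  have monic: "coeff ?P (card R) = 1"
    using fin degP lead_coeff_prod[of "\<lambda>x. [:- x, 1:]" R] by simp
  have "R \<subseteq> {x. poly ?H x = 0}"
    using fin by (auto simp: roots poly_prod)
  hence "card R \<le> degree ?H"
    using card_mono[OF poly_roots_finite[OF H]] card_poly_roots_bound[OF H] le_trans by blast
  moreover have "degree ?H \<le> card R"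
    using deg degP by (intro degree_diff_le) auto
  ultimately have "coeff ?H (card R) \<noteq> 0" using H by (metis leading_coeff_0_iff le_antisym)
  thus False by (simp add: monic)
qed

section \<open>Tuples of polynomials\<close>

text \<open>Vanishing coefficients, rather than a strict bound on \<open>degree\<close>, admit the
  zero polynomial for every \<open>n\<close>. Hence this is a group of exactly \<open>2 ^ n\<close>
  elements, also for \<open>n = 0\<close>.\<close>

definition polys_below :: "nat \<Rightarrow> bit poly set" where
  "polys_below n = {f. \<forall>j\<ge>n. coeff f j = 0}"

lemma polys_below_simps [simp]:
  "0 \<in> polys_below n"
  "f \<in> polys_below n \<Longrightarrow> g \<in> polys_below n \<Longrightarrow> f + g \<in> polys_below n"
  "f \<in> polys_below n \<Longrightarrow> g \<in> polys_below n \<Longrightarrow> f - g \<in> polys_below n"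
  by (simp_all add: polys_below_def)

lemma polys_below_mono: "n \<le> n' \<Longrightarrow> polys_below n \<subseteq> polys_below n'"
  by (auto simp: polys_below_def)

lemma polys_below_0 [simp]: "polys_below 0 = {0}"
  by (auto simp: polys_below_def poly_eq_iff)

lemma pCons_in_polys_below_iff [simp]: "pCons a f \<in> polys_below (Suc n) \<longleftrightarrow> f \<in> polys_below n"
proof
  assume *: "pCons a f \<in> polys_below (Suc n)"
  have "coeff f j = 0" if "j \<ge> n" for j
    using * that by (auto simp: polys_below_def dest!: spec[of _ "Suc j"])
  thus "f \<in> polys_below n" by (simp add: polys_below_def)
next
  assume *: "f \<in> polys_below n"
  have "coeff (pCons a f) j = 0" if "j \<ge> Suc n" for j
    using * that by (cases j) (auto simp: polys_below_def)
  thus "pCons a f \<in> polys_below (Suc n)" by (simp add: polys_below_def)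
qed

lemma polys_below_Suc: "polys_below (Suc n) = (\<lambda>(a, f). pCons a f) ` (UNIV \<times> polys_below n)"
proof (intro equalityI subsetI)
  fix f assume "f \<in> polys_below (Suc n)"
  thus "f \<in> (\<lambda>(a, f). pCons a f) ` (UNIV \<times> polys_below n)" by (cases f) auto
qed auto

lemma card_polys_below: "card (polys_below n) = 2 ^ n"
  and finite_polys_below: "finite (polys_below n)"
proof (induction n)
  case (Suc n)
  have "inj_on (\<lambda>(a, f). pCons a f) (UNIV \<times> polys_below n)" by (auto simp: inj_on_def)
  thus "card (polys_below (Suc n)) = 2 ^ Suc n"
    using Suc by (simp add: polys_below_Suc card_image card_cartesian_product card_UNIV_bit)
  show "finite (polys_below (Suc n))"
    using Suc by (simp add: polys_below_Suc finite_UNIV_bit)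
qed auto

lemma mult_in_polys_below:
  assumes "f \<in> polys_below a" "g \<in> polys_below b"
  shows "f * g \<in> polys_below (a + b - 1)"
  unfolding polys_below_def
proof safe
  fix j assume "a + b - 1 \<le> j"
  hence "coeff f i * coeff g (j - i) = 0" if "i \<le> j" for i
    using assms that by (cases "a \<le> i"; cases "b \<le> j - i") (auto simp: polys_below_def)
  thus "coeff (f * g) j = 0" unfolding coeff_mult by (intro sum.neutral) auto
qed

text \<open>Tuples of polynomials are encoded as polynomials in an outer variable whose exponent is the
  index of the block.\<close>

definition block_polys :: "nat set \<Rightarrow> (nat \<Rightarrow> nat) \<Rightarrow> bit poly poly set" where
  "block_polys J n = {p. (\<forall>i\<in>J. coeff p i \<in> polys_below (n i)) \<and> (\<forall>i. i \<notin> J \<longrightarrow> coeff p i = 0)}"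

lemma block_polysD:
  "p \<in> block_polys J n \<Longrightarrow> i \<in> J \<Longrightarrow> coeff p i \<in> polys_below (n i)"
  "p \<in> block_polys J n \<Longrightarrow> i \<notin> J \<Longrightarrow> coeff p i = 0"
  by (simp_all add: block_polys_def)

lemma block_polys_simps [simp]:
  "0 \<in> block_polys J n"
  "p \<in> block_polys J n \<Longrightarrow> q \<in> block_polys J n \<Longrightarrow> p + q \<in> block_polys J n"
  "p \<in> block_polys J n \<Longrightarrow> q \<in> block_polys J n \<Longrightarrow> p - q \<in> block_polys J n"
  by (auto simp: block_polys_def)

lemma card_block_polys:
  assumes "finite J"
  shows "card (block_polys J n) = 2 ^ (\<Sum>i\<in>J. n i)" and "finite (block_polys J n)"
proof -
  let ?g = "\<lambda>f. \<Sum>i\<in>J. monom (f i) i"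
  have coeff_g: "coeff (?g f) i = (if i \<in> J then f i else 0)" for f i
    using assms by (simp add: coeff_sum)
  have bij: "bij_betw ?g (\<Pi>\<^sub>E i\<in>J. polys_below (n i)) (block_polys J n)"
  proof (rule bij_betw_byWitness[where f' = "\<lambda>p. restrict (coeff p) J"])
    show "?g ` (\<Pi>\<^sub>E i\<in>J. polys_below (n i)) \<subseteq> block_polys J n"
      by (auto simp: block_polys_def coeff_g)
    show "(\<lambda>p. restrict (coeff p) J) ` block_polys J n \<subseteq> (\<Pi>\<^sub>E i\<in>J. polys_below (n i))"
      by (auto dest: block_polysD)
    show "\<forall>f\<in>\<Pi>\<^sub>E i\<in>J. polys_below (n i). restrict (coeff (?g f)) J = f"
      by (auto simp: coeff_g fun_eq_iff PiE_def extensional_def)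
    show "\<forall>p\<in>block_polys J n. ?g (restrict (coeff p) J) = p"
      by (auto simp: poly_eq_iff[where 'a = "bit poly"] coeff_g block_polysD)
  qed
  show "card (block_polys J n) = 2 ^ (\<Sum>i\<in>J. n i)"
    using bij_betw_same_card[OF bij] assms by (simp add: card_PiE card_polys_below power_sum)
  show "finite (block_polys J n)"
    using bij_betw_finite[OF bij] assms by (simp add: finite_PiE finite_polys_below)
qed

section \<open>The spaces of combinations with bounded coefficients and their growth\<close>

definition poly_span :: "bit poly poly set \<Rightarrow> nat \<Rightarrow> bit poly poly set" where
  "poly_span S k = {\<Sum>p\<in>S. smult (f p) p | f. \<forall>p. f p \<in> polys_below k}"

lemma poly_spanI: "(\<And>p. f p \<in> polys_below k) \<Longrightarrow> (\<Sum>p\<in>S. smult (f p) p) \<in> poly_span S k"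
  by (auto simp: poly_span_def)

lemma poly_spanE:
  assumes "w \<in> poly_span S k"
  obtains f where "\<And>p. f p \<in> polys_below k" "w = (\<Sum>p\<in>S. smult (f p) p)"
  using assms by (auto simp: poly_span_def)

lemma poly_span_add: "v \<in> poly_span S k \<Longrightarrow> w \<in> poly_span S k \<Longrightarrow> v + w \<in> poly_span S k"
proof (elim poly_spanE)
  fix f g assume "\<And>p. f p \<in> polys_below k" "\<And>p. g p \<in> polys_below k"
    "v = (\<Sum>p\<in>S. smult (f p) p)" "w = (\<Sum>p\<in>S. smult (g p) p)"
  thus ?thesis
    using poly_spanI[of "\<lambda>p. f p + g p" k S] by (simp add: smult_add_left sum.distrib)
qed

lemma poly_span_diff: "v \<in> poly_span S k \<Longrightarrow> w \<in> poly_span S k \<Longrightarrow> v - w \<in> poly_span S k"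
proof (elim poly_spanE)
  fix f g assume "\<And>p. f p \<in> polys_below k" "\<And>p. g p \<in> polys_below k"
    "v = (\<Sum>p\<in>S. smult (f p) p)" "w = (\<Sum>p\<in>S. smult (g p) p)"
  thus ?thesis
    using poly_spanI[of "\<lambda>p. f p - g p" k S] by (simp add: smult_diff_left sum_subtractf)
qed

lemma poly_span_0 [simp]: "poly_span S 0 = {0}"
  by (auto simp: poly_span_def intro: exI[of _ "\<lambda>_. 0"])

lemma zero_in_poly_span [simp]: "0 \<in> poly_span S k"
  using poly_spanI[of "\<lambda>_. 0"] by simp

lemma poly_span_sum: "(\<And>i. i \<in> I \<Longrightarrow> w i \<in> poly_span S k) \<Longrightarrow> sum w I \<in> poly_span S k"
  by (induction I rule: infinite_finite_induct) (auto intro: poly_span_add)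

lemma poly_span_mono: "k \<le> k' \<Longrightarrow> poly_span S k \<subseteq> poly_span S k'"
  using polys_below_mono by (auto elim!: poly_spanE intro!: poly_spanI)

lemma smult_sum_right: "smult c (\<Sum>i\<in>I. f i) = (\<Sum>i\<in>I. smult c (f i))"
  by (induction I rule: infinite_finite_induct) (simp_all add: smult_add_right)

lemma smult_in_poly_span:
  assumes "w \<in> poly_span S b" "g \<in> polys_below a"
  shows "smult g w \<in> poly_span S (a + b - 1)"
proof -
  from assms(1) obtain f where f: "\<And>p. f p \<in> polys_below b" "w = (\<Sum>p\<in>S. smult (f p) p)"
    by (rule poly_spanE) blast
  have "smult g w = (\<Sum>p\<in>S. smult (g * f p) p)"
    by (simp add: f(2) smult_sum_right)
  thus ?thesis using poly_spanI[of "\<lambda>p. g * f p"] mult_in_polys_below[OF assms(2) f(1)] by simp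
qed

lemma in_poly_span_1:
  assumes "finite S" "p \<in> S"
  shows "p \<in> poly_span S 1"
proof -
  have "(\<Sum>q\<in>S. smult (if q = p then 1 else 0) q) \<in> poly_span S 1"
    by (rule poly_spanI) (auto simp: polys_below_def)
  also have "(\<Sum>q\<in>S. smult (if q = p then 1 else 0) q) = p"
    using assms by (simp add: if_distrib[of "\<lambda>c. smult c _"] if_distribR cong: if_cong)
  finally show ?thesis .
qed

text \<open>Degrees add under multiplication. The resulting bound equals the number
  \<open>s i + k - 1\<close> of parameters of block \<open>i\<close>, so that elements of the span
  can be paired with parameters coefficient by coefficient.\<close>

lemma poly_span_subset_block_polys:
  assumes S: "S \<subseteq> block_polys J s" and s: "\<And>i. i \<in> J \<Longrightarrow> 1 \<le> s i"
  shows "poly_span S k \<subseteq> block_polys J (\<lambda>i. s i - 1 + k)"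
proof
  fix w assume "w \<in> poly_span S k"
  then obtain f where f: "\<And>p. f p \<in> polys_below k" "w = (\<Sum>p\<in>S. smult (f p) p)"
    by (rule poly_spanE) blast
  have "smult (f p) p \<in> block_polys J (\<lambda>i. s i - 1 + k)" if "p \<in> S" for p
    unfolding block_polys_def
  proof safe
    fix i assume "i \<in> J"
    thus "coeff (smult (f p) p) i \<in> polys_below (s i - 1 + k)"
      using mult_in_polys_below[OF f(1)[of p] block_polysD(1)[of p J s i]] S s[of i] that
      by (auto simp: add.commute)
  next
    fix i assume "i \<notin> J"
    thus "coeff (smult (f p) p) i = 0"
      using block_polysD(2)[of p J s i] S that by auto
  qed
  thus "w \<in> block_polys J (\<lambda>i. s i - 1 + k)"
    unfolding f(2) by (induction S rule: infinite_finite_induct) auto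
qed

text \<open>The concavity of the dimension, stated for cardinalities. With
  \<open>W = poly_span S (k + 1)\<close>, the larger span lies in \<open>W + x W\<close> and
  \<open>x * poly_span S k\<close> lies in \<open>W \<inter> x W\<close>;
  \<open>card_sum_Int_subgroups\<close> combines the two inclusions.\<close>

lemma card_poly_span_log_concave:
  assumes fin: "\<And>k. finite (poly_span S k)"
  shows "card (poly_span S (k + 2)) * card (poly_span S k) \<le> card (poly_span S (k + 1)) ^ 2"
proof -
  let ?X = "smult [:0, 1::bit:]" and ?W = "poly_span S (k + 1)"
  have X: "[:0, 1::bit:] \<in> polys_below 2" by (simp add: numeral_2_eq_2)
  have inj: "inj_on ?X A" for A
    by (auto simp: inj_on_def poly_eq_iff[where 'a = "bit poly"])
  have "poly_span S (k + 2) \<subseteq> (\<lambda>(a, b). a + b) ` (?W \<times> ?X ` ?W)"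
  proof
    fix w assume "w \<in> poly_span S (k + 2)"
    then obtain f where f: "\<And>p. f p \<in> polys_below (k + 2)" "w = (\<Sum>p\<in>S. smult (f p) p)"
      by (rule poly_spanE) blast
    \<comment> \<open>Each coefficient is split into its constant term and \<open>x\<close> times a
      quotient that has lost one degree.\<close>
    have "\<exists>a g. f p = pCons a g \<and> g \<in> polys_below (k + 1)" for p
      using f(1)[of p] by (cases "f p") auto
    then obtain a g where ag: "\<And>p. f p = pCons (a p) (g p)" "\<And>p. g p \<in> polys_below (k + 1)"
      by metis
    have split: "f p = [:a p:] + [:0, 1:] * g p" for p
      using ag(1) by (cases "a p") simp_all
    have "w = (\<Sum>p\<in>S. smult [:a p:] p) + ?X (\<Sum>p\<in>S. smult (g p) p)"
      by (simp only: f(2) smult_sum_right smult_smult split sum.distrib smult_add_left)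
    moreover have "(\<Sum>p\<in>S. smult [:a p:] p) \<in> ?W" "(\<Sum>p\<in>S. smult (g p) p) \<in> ?W"
      using ag(2) by (auto intro!: poly_spanI)
    ultimately show "w \<in> (\<lambda>(a, b). a + b) ` (?W \<times> ?X ` ?W)" by blast
  qed
  hence 1: "card (poly_span S (k + 2)) \<le> card ((\<lambda>(a, b). a + b) ` (?W \<times> ?X ` ?W))"
    by (intro card_mono finite_imageI finite_cartesian_product fin)
  have "?X ` poly_span S k \<subseteq> ?W \<inter> ?X ` ?W"
    using smult_in_poly_span[OF _ X, of _ S k] poly_span_mono[of k "k + 1" S] by auto
  hence "card (?X ` poly_span S k) \<le> card (?W \<inter> ?X ` ?W)"
    by (intro card_mono finite_Int) (use fin in auto)
  hence 2: "card (poly_span S k) \<le> card (?W \<inter> ?X ` ?W)"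
    by (simp add: card_image[OF inj])
  have "card ((\<lambda>(a, b). a + b) ` (?W \<times> ?X ` ?W)) * card (?W \<inter> ?X ` ?W) = card ?W * card (?X ` ?W)"
    by (rule card_sum_Int_subgroups) (use fin in \<open>auto intro: poly_span_diff simp flip: smult_diff_right\<close>)
  with mult_le_mono[OF 1 2] show ?thesis
    by (simp add: card_image[OF inj] power2_eq_square)
qed

text \<open>Take \<open>\<rho>\<close> as the least size of a set \<open>I\<close> of coordinates
  that detects nonzero elements. Projection to \<open>I\<close> is injective, which bounds the span
  from above. Minimality provides for each \<open>i \<in> I\<close> an element whose only nonzero
  coordinate within \<open>I\<close> is the one at \<open>i\<close>; their polynomial multiples are
  independent, which gives the lower bound.\<close>

lemma poly_span_growth:
  assumes J: "finite J" and s: "\<And>i. i \<in> J \<Longrightarrow> 1 \<le> s i" and S: "finite S" "S \<subseteq> block_polys J s"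
  obtains \<rho> c where "\<rho> \<le> card J" "S \<subseteq> {0} \<or> 1 \<le> \<rho>"
    "\<And>k. card (poly_span S k) \<le> 2 ^ (\<rho> * k + (\<Sum>i\<in>J. s i - 1))"
    "\<And>n. 2 ^ (\<rho> * n) \<le> card (poly_span S (n + c))"
proof -
  have sub: "poly_span S k \<subseteq> block_polys J (\<lambda>i. s i - 1 + k)" for k
    by (rule poly_span_subset_block_polys[OF S(2) s])
  have fin: "finite (poly_span S k)" for k
    by (rule finite_subset[OF sub card_block_polys(2)[OF J]])
  \<comment> \<open>All \<open>k\<close> are taken at once, so \<open>I\<close> has to work for the
    whole module generated by \<open>S\<close> and \<open>\<rho>\<close> does not depend on
    \<open>k\<close>.\<close>
  define determining where
    "determining I \<longleftrightarrow> I \<subseteq> J \<and> (\<forall>k. \<forall>w\<in>poly_span S k. (\<forall>i\<in>I. coeff w i = 0) \<longrightarrow> w = 0)" for I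
  have "determining J"
    unfolding determining_def
  proof safe
    fix k w assume w: "w \<in> poly_span S k" "\<forall>i\<in>J. coeff w i = 0"
    have "w \<in> block_polys J (\<lambda>i. s i - 1 + k)" using w sub by blast
    thus "w = 0" using w(2) block_polysD(2) by (metis poly_eqI coeff_0)
  qed
  then obtain I where I: "determining I" "\<And>I'. determining I' \<Longrightarrow> card I \<le> card I'"
    using ex_has_least_nat[of determining J card] by blast
  have finI: "finite I" using I(1) J finite_subset by (auto simp: determining_def)
  have "\<exists>k w. w \<in> poly_span S k \<and> (\<forall>j\<in>I - {i}. coeff w j = 0) \<and> coeff w i \<noteq> 0" if "i \<in> I" for i
  proof -
    have "card (I - {i}) < card I" using that finI by (rule card_Diff1_less[rotated])
    hence "\<not> determining (I - {i})" using I(2)[of "I - {i}"] by linarith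
    then obtain k w where w: "w \<in> poly_span S k" "\<forall>j\<in>I - {i}. coeff w j = 0" "w \<noteq> 0"
      using I(1) unfolding determining_def by blast
    hence "coeff w i \<noteq> 0"
      using I(1) unfolding determining_def by (metis Diff_iff singletonD)
    with w show ?thesis by blast
  qed
  then obtain \<kappa> v where v: "\<And>i. i \<in> I \<Longrightarrow> v i \<in> poly_span S (\<kappa> i)"
    "\<And>i j. i \<in> I \<Longrightarrow> j \<in> I \<Longrightarrow> j \<noteq> i \<Longrightarrow> coeff (v i) j = 0" "\<And>i. i \<in> I \<Longrightarrow> coeff (v i) i \<noteq> 0"
    by (metis DiffI singletonD)
  \<comment> \<open>A common bound for the finitely many levels \<open>\<kappa> i\<close> at which
    the elements \<open>v i\<close> appear.\<close>
  define c where "c = sum \<kappa> I"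
  have c: "\<kappa> i \<le> c" if "i \<in> I" for i
    using that finI unfolding c_def by (intro member_le_sum) auto
  show ?thesis
  proof (rule that[of "card I" c])
    show "card I \<le> card J" using I(2) \<open>determining J\<close> by blast
    show "S \<subseteq> {0} \<or> 1 \<le> card I"
    proof (cases "I = {}")
      case True
      hence "p = 0" if "p \<in> S" for p
        using I(1) in_poly_span_1[OF S(1) that] unfolding determining_def by blast
      thus ?thesis by blast
    next
      case False
      thus ?thesis using finI by (simp add: Suc_le_eq card_gt_0_iff)
    qed
  next
    fix k
    let ?g = "\<lambda>w :: bit poly poly. \<Sum>i\<in>I. monom (coeff w i) i"
    have coeff_g: "coeff (?g w) i = (if i \<in> I then coeff w i else 0)" for w i
      using finI by (simp add: coeff_sum)
    have "inj_on ?g (poly_span S k)"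
    proof (rule inj_onI)
      fix w w' assume w: "w \<in> poly_span S k" "w' \<in> poly_span S k" "?g w = ?g w'"
      have "coeff (w - w') i = 0" if "i \<in> I" for i
        using arg_cong[OF w(3), of "\<lambda>p. coeff p i"] that unfolding coeff_g by simp
      hence "w - w' = 0"
        using I(1) poly_span_diff[OF w(1,2)] unfolding determining_def by blast
      thus "w = w'" by simp
    qed
    moreover have "?g ` poly_span S k \<subseteq> block_polys I (\<lambda>i. s i - 1 + k)"
    proof (rule image_subsetI)
      fix w assume "w \<in> poly_span S k"
      hence "w \<in> block_polys J (\<lambda>i. s i - 1 + k)" using sub by blast
      moreover have "I \<subseteq> J" using I(1) by (simp add: determining_def)
      ultimately show "?g w \<in> block_polys I (\<lambda>i. s i - 1 + k)"
        by (auto simp: block_polys_def coeff_g)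
    qed
    ultimately have "card (poly_span S k) \<le> card (block_polys I (\<lambda>i. s i - 1 + k))"
      using card_block_polys(2)[OF finI] by (rule card_inj_on_le)
    also have "\<dots> = 2 ^ (card I * k + (\<Sum>i\<in>I. s i - 1))"
      by (simp add: card_block_polys(1)[OF finI] sum.distrib add.commute)
    \<comment> \<open>Enlarging the constant from \<open>I\<close> to \<open>J\<close> makes it the
      same for every \<open>S\<close>.\<close>
    also have "\<dots> \<le> 2 ^ (card I * k + (\<Sum>i\<in>J. s i - 1))"
      using I(1) J by (intro power_increasing add_left_mono sum_mono2) (auto simp: determining_def)
    finally show "card (poly_span S k) \<le> 2 ^ (card I * k + (\<Sum>i\<in>J. s i - 1))" .
  next
    fix n
    let ?g = "\<lambda>g :: bit poly poly. \<Sum>i\<in>I. smult (coeff g i) (v i)"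
    \<comment> \<open>Coordinate \<open>j\<close> sees only the summand of \<open>v j\<close>. As
      \<open>coeff (v j) j\<close> is nonzero in an integral domain, it can be cancelled, and
      \<open>g\<close> is recovered.\<close>
    have coeff_g: "coeff (?g g) j = coeff g j * coeff (v j) j" if "j \<in> I" for g j
    proof -
      have "coeff (?g g) j = (\<Sum>i\<in>I. if i = j then coeff g j * coeff (v j) j else 0)"
        unfolding coeff_sum using that by (intro sum.cong) (auto simp: v(2))
      thus ?thesis using that finI by simp
    qed
    have "inj_on ?g (block_polys I (\<lambda>_. n))"
    proof (rule inj_onI)
      fix g g' assume g: "g \<in> block_polys I (\<lambda>_. n)" "g' \<in> block_polys I (\<lambda>_. n)" "?g g = ?g g'"
      have "coeff g j = coeff g' j" for j
      proof (cases "j \<in> I")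
        case True
        thus ?thesis using arg_cong[OF g(3), of "\<lambda>p. coeff p j"] v(3) by (simp add: coeff_g)
      next
        case False
        thus ?thesis using g block_polysD(2) by metis
      qed
      thus "g = g'" by (rule poly_eqI)
    qed
    moreover have "?g ` block_polys I (\<lambda>_. n) \<subseteq> poly_span S (n + c)"
    proof (intro image_subsetI poly_span_sum)
      fix g i assume g: "g \<in> block_polys I (\<lambda>_. n)" "i \<in> I"
      have "smult (coeff g i) (v i) \<in> poly_span S (n + \<kappa> i - 1)"
        using smult_in_poly_span[OF v(1)] block_polysD(1)[OF g] g(2) by blast
      thus "smult (coeff g i) (v i) \<in> poly_span S (n + c)"
        using poly_span_mono[of "n + \<kappa> i - 1" "n + c" S] c[OF g(2)] by (meson subsetD diff_le_self add_left_mono le_trans)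
    qed
    ultimately have "card (block_polys I (\<lambda>_. n)) \<le> card (poly_span S (n + c))"
      using fin by (rule card_inj_on_le)
    thus "2 ^ (card I * n) \<le> card (poly_span S (n + c))"
      by (simp add: card_block_polys(1)[OF finI])
  qed
qed

section \<open>The pairing between tuples of polynomials and parameters\<close>

definition block_pairing ::
  "nat \<Rightarrow> (nat \<Rightarrow> nat) \<Rightarrow> nat \<Rightarrow> bit poly poly \<Rightarrow> (nat \<Rightarrow> nat \<Rightarrow> bit) \<Rightarrow> bit" where
  "block_pairing m s k w \<alpha> = (\<Sum>i = 1..m. \<Sum>j < s i + k - 1. coeff (coeff w i) j * \<alpha> i (j + 1))"

lemma block_pairing_0 [simp]: "block_pairing m s k 0 \<alpha> = 0"
  by (simp add: block_pairing_def)

lemma block_pairing_add: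
  "block_pairing m s k (v + w) \<alpha> = block_pairing m s k v \<alpha> + block_pairing m s k w \<alpha>"
  by (simp only: block_pairing_def coeff_add distrib_right sum.distrib)

lemma block_pairing_sum:
  "block_pairing m s k (\<Sum>x\<in>A. w x) \<alpha> = (\<Sum>x\<in>A. block_pairing m s k (w x) \<alpha>)"
  by (induction A rule: infinite_finite_induct)
    (simp_all only: block_pairing_add block_pairing_0 sum.infinite sum.empty sum.insert if_False not_False_eq_True)

lemma card_persymmetric_params:
  assumes "\<And>i. i \<in> {1..m} \<Longrightarrow> 1 \<le> s i"
  shows "card (persymmetric_params m s k) = 2 ^ ((\<Sum>i = 1..m. s i - 1) + m * k)"
    and "finite (persymmetric_params m s k)"
proof -
  have "(\<Sum>i = 1..m. s i + k - 1) = (\<Sum>i = 1..m. (s i - 1) + k)"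
    using assms by (intro sum.cong) auto
  thus "card (persymmetric_params m s k) = 2 ^ ((\<Sum>i = 1..m. s i - 1) + m * k)"
    by (simp add: persymmetric_params_def card_PiE card_UNIV_bit sum.distrib flip: power_sum)
  show "finite (persymmetric_params m s k)"
    by (simp add: persymmetric_params_def finite_PiE finite_UNIV_bit)
qed

lemma bit_add_1_1: "(a :: bit) + 1 + 1 = a"
  by (cases a) simp_all

text \<open>Nondegeneracy of the pairing: if coefficient \<open>j\<close> of
  \<open>coeff w i\<close> is 1, toggling the parameter \<open>\<alpha> i (j + 1)\<close> is an
  involution that changes the value by 1.\<close>

lemma block_pairing_flip:
  assumes w: "w \<in> block_polys {1..m} (\<lambda>i. s i - 1 + k)" "w \<noteq> 0"
    and s: "\<And>i. i \<in> {1..m} \<Longrightarrow> 1 \<le> s i"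
  shows "\<exists>g. bij_betw g (persymmetric_params m s k) (persymmetric_params m s k) \<and>
             (\<forall>\<alpha>\<in>persymmetric_params m s k. block_pairing m s k w (g \<alpha>) = block_pairing m s k w \<alpha> + 1)"
proof -
  from w(2) obtain i where "coeff w i \<noteq> 0" by (auto simp: poly_eq_iff[where 'a = "bit poly"])
  then obtain j where ij: "coeff (coeff w i) j = 1" by (auto simp: poly_eq_iff[where 'a = bit])
  have i: "i \<in> {1..m}" using ij block_polysD(2)[OF w(1)] by force
  \<comment> \<open>The degree bound on \<open>w\<close> guarantees that the parameter with index
    \<open>j + 1\<close> exists.\<close>
  hence j: "j < s i + k - 1"
    using ij block_polysD(1)[OF w(1) i] s[OF i] unfolding polys_below_def
    by (metis (mono_tags, lifting) mem_Collect_eq not_less zero_neq_one Nat.add_diff_assoc2)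
  define g :: "(nat \<Rightarrow> nat \<Rightarrow> bit) \<Rightarrow> _" where "g \<alpha> = \<alpha>(i := (\<alpha> i)(j + 1 := \<alpha> i (j + 1) + 1))" for \<alpha>
  have g: "g \<alpha> \<in> persymmetric_params m s k" if "\<alpha> \<in> persymmetric_params m s k" for \<alpha>
    using that i j unfolding persymmetric_params_def PiE_iff g_def
    by (auto simp: extensional_def)
  have gg: "g (g \<alpha>) = \<alpha>" for \<alpha>
    by (simp only: g_def fun_upd_same fun_upd_upd bit_add_1_1 fun_upd_triv)
  have "block_pairing m s k w (g \<alpha>) = block_pairing m s k w \<alpha> + 1" for \<alpha>
  proof -
    have g_eq: "g \<alpha> i' (j' + 1) = \<alpha> i' (j' + 1) + (if i' = i then if j' = j then 1 else 0 else 0)" for i' j'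
      unfolding g_def by (cases "i' = i"; cases "j' = j") auto
    have "block_pairing m s k w (g \<alpha>) = block_pairing m s k w \<alpha> +
       (\<Sum>i' = 1..m. \<Sum>j' < s i' + k - 1. coeff (coeff w i') j' * (if i' = i then if j' = j then 1 else 0 else 0))"
      unfolding block_pairing_def g_eq distrib_left sum.distrib ..
    also have "(\<Sum>i' = 1..m. \<Sum>j' < s i' + k - 1. coeff (coeff w i') j' * (if i' = i then if j' = j then 1 else 0 else 0))
       = (\<Sum>i' = 1..m. if i' = i then (\<Sum>j' < s i' + k - 1. if j' = j then coeff (coeff w i') j' else 0) else 0)"
      by (rule sum.cong[OF refl], split if_split, intro conjI impI)
        (simp_all only: if_True if_False if_distrib[of "(*) _"] mult_1_right mult_zero_right sum.neutral_const simp_thms)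
    also have "\<dots> = (\<Sum>j' < s i + k - 1. if j' = j then coeff (coeff w i) j' else 0)"
      using i by (simp only: sum.delta finite_atLeastAtMost if_True)
    also have "\<dots> = 1"
      using j ij by (simp only: sum.delta finite_lessThan lessThan_iff if_True)
    finally show ?thesis .
  qed
  moreover have "bij_betw g (persymmetric_params m s k) (persymmetric_params m s k)"
    by (rule bij_betw_byWitness[where f' = g]) (use g gg in auto)
  ultimately show ?thesis by blast
qed

section \<open>Counting the annihilated parameters\<close>

text \<open>The tuple \<open>p\<close> stands for a linear relation between the rows: the
  coefficient of \<open>x ^ (r - 1)\<close> in \<open>coeff p i\<close> is the weight of row
  \<open>r\<close> of block \<open>i\<close>, and \<open>c\<close> runs over the columns.\<close>

definition left_annihilates ::
  "nat \<Rightarrow> (nat \<Rightarrow> nat) \<Rightarrow> nat \<Rightarrow> bit poly poly \<Rightarrow> (nat \<Rightarrow> nat \<Rightarrow> bit) \<Rightarrow> bool" where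
  "left_annihilates m s k p \<alpha> \<longleftrightarrow>
     (\<forall>c<k. (\<Sum>i = 1..m. \<Sum>r = 1..s i. coeff (coeff p i) (r - 1) * \<alpha> i (r + c)) = 0)"

text \<open>Multiplication by \<open>x ^ c\<close> moves the weight of row \<open>r\<close> to
  position \<open>r - 1 + c\<close>, which is paired with \<open>\<alpha> i (r + c)\<close>, the
  entry of that row in column \<open>c\<close>. The Hankel structure thus turns columns into powers
  of \<open>x\<close>.\<close>

lemma block_pairing_monom:
  assumes "p \<in> block_polys {1..m} s" "c < k"
  shows "block_pairing m s k (smult (monom 1 c) p) \<alpha> =
         (\<Sum>i = 1..m. \<Sum>r = 1..s i. coeff (coeff p i) (r - 1) * \<alpha> i (r + c))"
  unfolding block_pairing_def
proof (rule sum.cong[OF refl])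
  fix i assume i: "i \<in> {1..m}"
  let ?h = "\<lambda>j. coeff (coeff (smult (monom 1 c) p) i) j * \<alpha> i (j + 1)"
  have h: "?h j = (if c \<le> j then coeff (coeff p i) (j - c) * \<alpha> i (j + 1) else 0)" for j
    by (simp add: coeff_monom_mult)
  \<comment> \<open>The shifted coefficients live in a window of length \<open>s i\<close>, which
    stays inside the index range because \<open>c < k\<close>.\<close>
  have "(\<Sum>j < s i + k - 1. ?h j) = (\<Sum>j = c..<c + s i. ?h j)"
  proof (rule sum.mono_neutral_right)
    show "\<forall>j\<in>{..<s i + k - 1} - {c..<c + s i}. ?h j = 0"
      using block_polysD(1)[OF assms(1) i] unfolding h polys_below_def by auto
  qed (use assms(2) in auto)
  also have "\<dots> = (\<Sum>r = 1..s i. coeff (coeff p i) (r - 1) * \<alpha> i (r + c))"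
    unfolding h
    by (rule sum.reindex_bij_witness[where i = "\<lambda>r. r - 1 + c" and j = "\<lambda>j. j - c + 1"]) auto
  finally show "(\<Sum>j < s i + k - 1. ?h j) = \<dots>" .
qed

text \<open>The products \<open>x ^ c * p\<close> with \<open>c < k\<close> and
  \<open>p \<in> S\<close> generate the span over the two-element field, and pairing with them
  yields exactly the column conditions.\<close>

lemma poly_span_annihilated_iff:
  assumes S: "finite S" "S \<subseteq> block_polys {1..m} s"
  shows "(\<forall>w\<in>poly_span S k. block_pairing m s k w \<alpha> = 0) \<longleftrightarrow> (\<forall>p\<in>S. left_annihilates m s k p \<alpha>)"
proof
  assume *: "\<forall>w\<in>poly_span S k. block_pairing m s k w \<alpha> = 0"
  show "\<forall>p\<in>S. left_annihilates m s k p \<alpha>"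
    unfolding left_annihilates_def
  proof (intro ballI allI impI)
    fix p c assume p: "p \<in> S" and c: "c < k"
    have "monom 1 c \<in> polys_below k" using c by (simp add: polys_below_def)
    from smult_in_poly_span[OF in_poly_span_1[OF S(1) p] this]
    have "smult (monom 1 c) p \<in> poly_span S k" by simp
    thus "(\<Sum>i = 1..m. \<Sum>r = 1..s i. coeff (coeff p i) (r - 1) * \<alpha> i (r + c)) = 0"
      using * block_pairing_monom[of p m s c k \<alpha>] p c S(2) by auto
  qed
next
  assume *: "\<forall>p\<in>S. left_annihilates m s k p \<alpha>"
  show "\<forall>w\<in>poly_span S k. block_pairing m s k w \<alpha> = 0"
  proof
    fix w assume "w \<in> poly_span S k"
    then obtain f where f: "\<And>p. f p \<in> polys_below k" "w = (\<Sum>p\<in>S. smult (f p) p)"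
      by (rule poly_spanE) blast
    have "block_pairing m s k (smult (f p) p) \<alpha> = 0" if p: "p \<in> S" for p
    proof -
      have "f p = (\<Sum>c<k. monom (coeff (f p) c) c)"
        using f(1)[of p] by (auto simp: poly_eq_iff coeff_sum polys_below_def not_less)
      hence "smult (f p) p = (\<Sum>c<k. smult (monom (coeff (f p) c) c) p)"
        by (metis smult_sum)
      moreover have "block_pairing m s k (smult (monom a c) p) \<alpha> = 0" if "c < k" for a c
        using block_pairing_monom[of p m s c k \<alpha>] p that S(2) *
        by (cases a) (auto simp: left_annihilates_def)
      ultimately show ?thesis by (simp only: block_pairing_sum) (simp add: sum.neutral)
    qed
    thus "block_pairing m s k w \<alpha> = 0" unfolding f(2) block_pairing_sum by (rule sum.neutral[OF ballI])
  qed
qed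

text \<open>Duality by counting: \<open>block_pairing_flip\<close> supplies the flips of the
  parameters, translation by an element of pairing value 1 supplies the shifts of the span.\<close>

lemma card_poly_span_mult_card_annihilated:
  assumes s: "\<And>i. i \<in> {1..m} \<Longrightarrow> 1 \<le> s i" and S: "finite S" "S \<subseteq> block_polys {1..m} s"
  shows "card (poly_span S k) * card {\<alpha> \<in> persymmetric_params m s k. \<forall>p\<in>S. left_annihilates m s k p \<alpha>}
         = 2 ^ ((\<Sum>i = 1..m. s i - 1) + m * k)"
proof -
  have sub: "poly_span S k \<subseteq> block_polys {1..m} (\<lambda>i. s i - 1 + k)"
    by (rule poly_span_subset_block_polys[OF S(2) s])
  have "card (poly_span S k) *
      card {\<alpha> \<in> persymmetric_params m s k. \<forall>w\<in>poly_span S k. block_pairing m s k w \<alpha> = 0}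
    = card (persymmetric_params m s k)"
  proof (rule card_mult_card_annihilator[where z = 0])
    show "finite (poly_span S k)"
      by (rule finite_subset[OF sub card_block_polys(2)]) simp
    show "\<exists>g. bij_betw g (persymmetric_params m s k) (persymmetric_params m s k) \<and>
             (\<forall>\<alpha>\<in>persymmetric_params m s k. block_pairing m s k w (g \<alpha>) = block_pairing m s k w \<alpha> + 1)"
      if "w \<in> poly_span S k" "w \<noteq> 0" for w
      using that sub by (intro block_pairing_flip s) auto
    show "\<exists>g. bij_betw g (poly_span S k) (poly_span S k) \<and>
             (\<forall>w\<in>poly_span S k. block_pairing m s k (g w) \<alpha> = block_pairing m s k w \<alpha> + 1)"
      if v: "v \<in> poly_span S k" "block_pairing m s k v \<alpha> = 1" for \<alpha> v
    proof (intro exI[of _ "\<lambda>w. w + v"] conjI ballI)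
      show "bij_betw (\<lambda>w. w + v) (poly_span S k) (poly_span S k)"
        by (rule bij_betw_byWitness[where f' = "\<lambda>w. w - v"]) (use v poly_span_add poly_span_diff in auto)
      show "block_pairing m s k (w + v) \<alpha> = block_pairing m s k w \<alpha> + 1" for w
        unfolding block_pairing_add v(2) ..
    qed
  qed (auto intro: card_persymmetric_params(2)[OF s])
  thus ?thesis
    by (simp only: poly_span_annihilated_iff[OF S] card_persymmetric_params(1)[where m = m and s = s and k = k, OF s])
qed

text \<open>The quantity for inclusion-exclusion: relations in \<open>A\<close> are imposed, those
  in \<open>B\<close> forbidden. The full rank count is the case where \<open>A\<close> is empty and
  \<open>B\<close> consists of all nonzero tuples.\<close>

definition annihilated_count ::
  "nat \<Rightarrow> (nat \<Rightarrow> nat) \<Rightarrow> bit poly poly set \<Rightarrow> bit poly poly set \<Rightarrow> nat \<Rightarrow> nat" where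
  "annihilated_count m s A B k = card {\<alpha> \<in> persymmetric_params m s k.
     (\<forall>p\<in>A. left_annihilates m s k p \<alpha>) \<and> (\<forall>p\<in>B. \<not> left_annihilates m s k p \<alpha>)}"

text \<open>The span has \<open>2 ^ d k\<close> elements, since its size divides a power of 2, and
  \<open>increments_eq_slope\<close> makes \<open>d\<close> affine with slope \<open>\<rho>\<close>
  from \<open>D\<close> on. A nonzero relation forces \<open>\<rho> \<ge> 1\<close>, so the exponent
  \<open>b = m - \<rho>\<close> stays below \<open>m\<close>.\<close>

lemma annihilated_count_monomial:
  assumes s: "\<And>i. i \<in> {1..m} \<Longrightarrow> 1 \<le> s i" and A: "finite A" "A \<subseteq> block_polys {1..m} s - {0}" "A \<noteq> {}"
  defines "D \<equiv> (\<Sum>i = 1..m. s i - 1)"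
  obtains a b where "b < m" "\<And>k. k \<ge> D \<Longrightarrow> annihilated_count m s A {} k = 2 ^ a * (2 ^ k) ^ b"
proof -
  have A': "A \<subseteq> block_polys {1..m} s" using A(2) by blast
  have mult: "card (poly_span A k) * annihilated_count m s A {} k = 2 ^ (D + m * k)" for k
    using card_poly_span_mult_card_annihilated[OF s A(1) A'] by (simp add: annihilated_count_def D_def)
  have "\<exists>d. card (poly_span A k) = 2 ^ d" for k
  proof -
    have "card (poly_span A k) dvd 2 ^ (D + m * k)" using mult[of k] by (metis dvd_triv_left)
    thus ?thesis by (auto simp: divides_primepow_nat)
  qed
  then obtain d where d: "\<And>k. card (poly_span A k) = 2 ^ d k" by metis
  obtain \<rho> c where \<rho>: "\<rho> \<le> card {1..m}" "A \<subseteq> {0} \<or> 1 \<le> \<rho>"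
    "\<And>k. card (poly_span A k) \<le> 2 ^ (\<rho> * k + (\<Sum>i\<in>{1..m}. s i - 1))"
    "\<And>n. 2 ^ (\<rho> * n) \<le> card (poly_span A (n + c))"
    using poly_span_growth[of "{1..m}" s A] s A(1) A' by blast
  have upper: "d k \<le> \<rho> * k + D" for k
    using \<rho>(3)[of k] by (simp add: d D_def)
  have lower: "\<rho> * n \<le> d (n + c)" for n
    using \<rho>(4)[of n] by (simp add: d)
  have concave: "d (n + 2) + d n \<le> 2 * d (n + 1)" for n
  proof -
    have fin: "finite (poly_span A k)" for k
      using d[of k] by (intro card_ge_0_finite) simp
    from card_poly_span_log_concave[OF this, of n] have "2 ^ (d (n + 2) + d n) \<le> (2 :: nat) ^ (d (n + 1) * 2)"
      by (simp only: d power_add power_mult)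
    thus ?thesis by (simp add: mult.commute)
  qed
  have d0: "d 0 = 0" using d[of 0] power_inject_exp[of "2 :: nat" "d 0" 0] by simp
  have step: "d (n + 1) = d n + \<rho>" if "n \<ge> D" for n
    by (rule increments_eq_slope[OF d0 concave upper lower that])
  have dk: "d k + \<rho> * D = d D + \<rho> * k" if "k \<ge> D" for k
    using that by (induction k rule: dec_induct) (use step in \<open>auto simp: algebra_simps\<close>)
  have \<rho>m: "\<rho> \<le> m" "1 \<le> \<rho>" using \<rho>(1,2) A by auto
  \<comment> \<open>The exponents come from \<open>D + m * k - d k\<close> with
    \<open>d k = d D + \<rho> * (k - D)\<close>. The natural subtraction in the second one is exact
    because \<open>d D \<le> \<rho> * D + D\<close>.\<close>
  show ?thesis
  proof (rule that[of "m - \<rho>" "\<rho> * D + D - d D"])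
    show "m - \<rho> < m" using \<rho>m by simp
    fix k assume k: "k \<ge> D"
    have "m * k = (m - \<rho>) * k + \<rho> * k"
      using \<rho>m by (simp flip: add_mult_distrib)
    hence "D + m * k = d k + ((\<rho> * D + D - d D) + k * (m - \<rho>))"
      using dk[OF k] upper[of D] by (simp add: mult.commute)
    hence "2 ^ d k * annihilated_count m s A {} k = 2 ^ d k * (2 ^ (\<rho> * D + D - d D) * (2 ^ k) ^ (m - \<rho>))"
      using mult[of k] by (simp add: d power_add power_mult)
    thus "annihilated_count m s A {} k = 2 ^ (\<rho> * D + D - d D) * (2 ^ k) ^ (m - \<rho>)" by simp
  qed
qed

text \<open>Inclusion-exclusion as an induction on \<open>B\<close>: forbidding one more relation
  subtracts the count in which it is imposed. The subtracted polynomial has coefficient 0 at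
  \<open>m\<close>, so only the unconstrained count contributes to the top coefficient.\<close>

lemma annihilated_count_polynomial:
  assumes s: "\<And>i. i \<in> {1..m} \<Longrightarrow> 1 \<le> s i"
    and "finite B" "B \<subseteq> block_polys {1..m} s - {0}" "finite A" "A \<subseteq> block_polys {1..m} s - {0}"
  defines "D \<equiv> (\<Sum>i = 1..m. s i - 1)"
  shows "\<exists>Q :: int poly. degree Q \<le> m \<and> coeff Q m = (if A = {} then 2 ^ D else 0) \<and>
           (\<forall>k\<ge>D. int (annihilated_count m s A B k) = poly Q (2 ^ k))"
  using assms(2-5)
proof (induction B arbitrary: A rule: finite_induct)
  case empty
  show ?case
  proof (cases "A = {}")
    case True
    have "annihilated_count m s A {} k = 2 ^ (D + m * k)" for k
      using card_persymmetric_params(1)[OF s, where k = k] by (simp add: annihilated_count_def True D_def)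
    thus ?thesis using True
      by (intro exI[of _ "monom (2 ^ D) m"])
        (simp add: degree_monom_le poly_monom power_add power_mult mult.commute[of m])
  next
    case False
    then obtain a b where "b < m" "\<And>k. k \<ge> D \<Longrightarrow> annihilated_count m s A {} k = 2 ^ a * (2 ^ k) ^ b"
      using annihilated_count_monomial[OF s empty(2,3)] unfolding D_def by blast
    thus ?thesis using False
      by (intro exI[of _ "monom (2 ^ a) b"]) (auto simp: poly_monom intro: order.trans[OF degree_monom_le])
  qed
next
  case (insert b B)
  obtain Q1 :: "int poly" where Q1: "degree Q1 \<le> m" "coeff Q1 m = (if A = {} then 2 ^ D else 0)"
    "\<And>k. k \<ge> D \<Longrightarrow> int (annihilated_count m s A B k) = poly Q1 (2 ^ k)"
    using insert.IH[of A] insert.prems by auto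
  obtain Q2 :: "int poly" where Q2: "degree Q2 \<le> m" "coeff Q2 m = 0"
    "\<And>k. k \<ge> D \<Longrightarrow> int (annihilated_count m s (insert b A) B k) = poly Q2 (2 ^ k)"
    using insert.IH[of "insert b A"] insert.prems by auto
  have "annihilated_count m s A B k = annihilated_count m s A (insert b B) k + annihilated_count m s (insert b A) B k" for k
    unfolding annihilated_count_def
    by (subst card_Un_disjoint[symmetric])
      (auto intro: finite_subset[OF _ card_persymmetric_params(2)[OF s, where k = k]] arg_cong[of _ _ card])
  hence "int (annihilated_count m s A (insert b B) k) = poly (Q1 - Q2) (2 ^ k)" if "k \<ge> D" for k
    using Q1(3)[OF that] Q2(3)[OF that] by simp
  thus ?case
    using Q1 Q2 by (intro exI[of _ "Q1 - Q2"]) (auto intro: degree_diff_le)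
qed

section \<open>Full row rank\<close>

lemma finite_carrier_vec_bit: "finite (carrier_vec n :: bit vec set)"
proof (rule finite_subset)
  show "carrier_vec n \<subseteq> vec n ` ({..<n} \<rightarrow>\<^sub>E (UNIV :: bit set))"
  proof
    fix v :: "bit vec" assume v: "v \<in> carrier_vec n"
    hence "v = vec n (restrict (($) v) {..<n})" by (intro eq_vecI) auto
    moreover have "restrict (($) v) {..<n} \<in> {..<n} \<rightarrow>\<^sub>E UNIV" by simp
    ultimately show "v \<in> vec n ` ({..<n} \<rightarrow>\<^sub>E UNIV)" by (rule image_eqI)
  qed
  show "finite (vec n ` ({..<n} \<rightarrow>\<^sub>E (UNIV :: bit set)))"
    by (intro finite_imageI finite_PiE) (simp_all add: finite_UNIV_bit)
qed

lemma bit_vec_add_cancel: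
  assumes "w \<in> carrier_vec n" "v \<in> carrier_vec n"
  shows "w + v + v = (w :: bit vec)"
proof -
  have "v + v = 0\<^sub>v n" using assms(2) by (intro eq_vecI) (auto simp only: index_add_vec index_zero_vec bit_add_self carrier_vecD)
  thus ?thesis using assms by (simp add: assoc_add_vec[of _ n])
qed

lemma scalar_prod_flip:
  assumes w: "w \<in> carrier_vec n" "w \<noteq> 0\<^sub>v n"
  shows "\<exists>g. bij_betw g (carrier_vec n) (carrier_vec n) \<and> (\<forall>\<alpha>\<in>carrier_vec n. w \<bullet> g \<alpha> = w \<bullet> \<alpha> + (1 :: bit))"
proof -
  from w obtain t where t: "t < n" "w $ t = 1" by (metis eq_vecI carrier_vecD index_zero_vec bit_not_zero_iff)
  let ?g = "\<lambda>\<alpha> :: bit vec. \<alpha> + unit_vec n t"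
  have "w \<bullet> ?g \<alpha> = w \<bullet> \<alpha> + 1" if "\<alpha> \<in> carrier_vec n" for \<alpha>
    using scalar_prod_add_distrib[OF w(1) that unit_vec_carrier] scalar_prod_right_unit[OF t(1), of w] t(2) by simp
  moreover have gg: "?g (?g \<alpha>) = \<alpha>" if "\<alpha> \<in> carrier_vec n" for \<alpha>
    using that by (intro bit_vec_add_cancel[of _ n]) auto
  have "bij_betw ?g (carrier_vec n) (carrier_vec n)"
  proof (rule bij_betw_byWitness[where f' = ?g])
    show "\<forall>\<alpha>\<in>carrier_vec n. ?g (?g \<alpha>) = \<alpha>" using gg by blast
    thus "\<forall>\<alpha>\<in>carrier_vec n. ?g (?g \<alpha>) = \<alpha>" .
    show "?g ` carrier_vec n \<subseteq> carrier_vec n" by auto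
    thus "?g ` carrier_vec n \<subseteq> carrier_vec n" .
  qed
  ultimately show ?thesis by blast
qed

lemma (in vec_space) zero_vec_in_span: "0\<^sub>v n \<in> span S"
  using vectorspace.span_zero[OF vectorspace_axioms, of S] by (simp add: module_vec_def)

lemma (in vec_space) add_vec_in_span:
  "S \<subseteq> carrier_vec n \<Longrightarrow> v \<in> span S \<Longrightarrow> w \<in> span S \<Longrightarrow> v + w \<in> span S"
  using span_add1[of S v w] by (simp add: module_vec_def)

lemma (in vec_space) span_subset_carrier_vec: "S \<subseteq> carrier_vec n \<Longrightarrow> span S \<subseteq> carrier_vec n"
  using span_is_subset2[of S] by (simp add: module_vec_def)

text \<open>A maximal independent set of columns has as many elements as the rank; \<open>n\<close>
  independent vectors in dimension \<open>n\<close> form a basis.\<close>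

lemma (in vec_space) rank_eq_n_iff_span:
  assumes A: "A \<in> carrier_mat n nc"
  shows "rank A = n \<longleftrightarrow> span (set (cols A)) = carrier_vec n"
proof -
  have cols: "set (cols A) \<subseteq> carrier_vec n" using A cols_dim by blast
  have sub: "span (set (cols A)) \<subseteq> carrier_vec n" using span_is_subset2[OF cols] by simp
  show ?thesis
  proof
    assume rank: "rank A = n"
    have indpt_empty: "lin_indpt {}" unfolding lin_dep_def by auto
    obtain S where S: "maximal S (\<lambda>T. T \<subseteq> set (cols A) \<and> lin_indpt T)" "finite S"
      using maximal_exists_superset[of "set (cols A)" "\<lambda>T. T \<subseteq> set (cols A) \<and> lin_indpt T" "{}"] indpt_empty
      by auto
    have S': "S \<subseteq> set (cols A)" "lin_indpt S" using S(1) by (auto simp: maximal_def)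
    have "card S = n" using rank_card_indpt[OF A S(1)] rank by simp
    hence "basis S"
      using S' S(2) cols by (intro dim_li_is_basis) (auto simp: dim_is_n)
    hence "span S = carrier_vec n" by (simp add: basis_def)
    thus "span (set (cols A)) = carrier_vec n"
      using span_is_monotone[OF S'(1)] sub by blast
  next
    assume "span (set (cols A)) = carrier_vec n"
    hence "rank A = dim" by (simp add: rank_def module_vec_def)
    thus "rank A = n" by (simp add: dim_is_n)
  qed
qed

text \<open>The sizes of the column span and of its orthogonal complement multiply to the size of
  the whole space, so the span is everything exactly if the complement is trivial. Counting works
  although a subspace over this field may meet its complement nontrivially.\<close>

lemma full_row_rank_iff:
  fixes A :: "bit mat"
  assumes A: "A \<in> carrier_mat n nc"
  shows "vec_space.rank n A = n \<longleftrightarrow>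
         (\<forall>w\<in>carrier_vec n. (\<forall>c<nc. w \<bullet> col A c = 0) \<longrightarrow> w = 0\<^sub>v n)"
proof -
  interpret vec_space "TYPE(bit)" n .
  let ?W = "span (set (cols A))"
  have cols: "set (cols A) \<subseteq> carrier_vec n" using A cols_dim by blast
  have sub: "?W \<subseteq> carrier_vec n" by (rule span_subset_carrier_vec[OF cols])
  have "card ?W * card {\<alpha> \<in> carrier_vec n. \<forall>w\<in>?W. w \<bullet> \<alpha> = 0}
      = card (carrier_vec n :: bit vec set)"
  proof (rule card_mult_card_annihilator[where z = "0\<^sub>v n"])
    show "finite ?W" using sub finite_carrier_vec_bit by (rule finite_subset)
    show "0\<^sub>v n \<in> ?W" by (rule zero_vec_in_span)
    show "\<exists>g. bij_betw g (carrier_vec n) (carrier_vec n) \<and> (\<forall>\<alpha>\<in>carrier_vec n. w \<bullet> g \<alpha> = w \<bullet> \<alpha> + 1)"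
      if "w \<in> ?W" "w \<noteq> 0\<^sub>v n" for w
      using that sub by (intro scalar_prod_flip) auto
    show "\<exists>g. bij_betw g ?W ?W \<and>
              (\<forall>w\<in>?W. g w \<bullet> \<alpha> = w \<bullet> \<alpha> + 1)"
      if \<alpha>: "\<alpha> \<in> carrier_vec n" and v: "v \<in> ?W" "v \<bullet> \<alpha> = 1" for \<alpha> v
    proof (intro exI[of _ "\<lambda>w. w + v"] conjI ballI)
      have [simp]: "v \<in> carrier_vec n" using v sub by blast
      have closed: "w + v \<in> ?W" if "w \<in> ?W" for w
        by (rule add_vec_in_span[OF cols that v(1)])
      have vv: "w + v + v = w" if "w \<in> ?W" for w
        using that sub by (intro bit_vec_add_cancel[of _ n]) auto
      show "bij_betw (\<lambda>w. w + v) ?W ?W"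
      proof (rule bij_betw_byWitness[where f' = "\<lambda>w. w + v"])
        show "\<forall>w\<in>?W. w + v + v = w" using vv by blast
        thus "\<forall>w\<in>?W. w + v + v = w" .
        show "(\<lambda>w. w + v) ` ?W \<subseteq> ?W" using closed by blast
        thus "(\<lambda>w. w + v) ` ?W \<subseteq> ?W" .
      qed
      show "(w + v) \<bullet> \<alpha> = w \<bullet> \<alpha> + 1" if "w \<in> ?W" for w
        using add_scalar_prod_distrib[of w n v \<alpha>] that sub \<alpha> v(2) by auto
    qed
  qed (auto simp: finite_carrier_vec_bit)
  also have "{\<alpha> \<in> carrier_vec n. \<forall>w\<in>?W. w \<bullet> \<alpha> = 0} = orthogonal_complement ?W"
    unfolding orthogonal_complement_def using sub comm_scalar_prod by (metis subsetD)
  also have "\<dots> = {\<alpha> \<in> carrier_vec n. \<forall>c<nc. \<alpha> \<bullet> col A c = 0}" (is "_ = ?K")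
    using A unfolding in_orthogonal_complement_span[OF cols]
    by (auto simp: orthogonal_complement_def cols_def)
  finally have prod: "card ?W * card ?K = card (carrier_vec n :: bit vec set)" .
  have pos: "card (carrier_vec n :: bit vec set) > 0"
    using finite_carrier_vec_bit[of n] by (auto simp: card_gt_0_iff intro: zero_carrier_vec)
  have K0: "0\<^sub>v n \<in> ?K" using A by auto
  have finK: "finite ?K" using finite_carrier_vec_bit[of n] by simp
  have "?W = carrier_vec n \<longleftrightarrow> card ?K = 1"
  proof
    assume "?W = carrier_vec n"
    thus "card ?K = 1" using prod pos by simp
  next
    assume "card ?K = 1"
    hence "card ?W = card (carrier_vec n :: bit vec set)" using prod by simp
    thus "?W = carrier_vec n"
      using card_subset_eq[OF finite_carrier_vec_bit sub] by blast
  qed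
  also have "\<dots> \<longleftrightarrow> ?K = {0\<^sub>v n}"
  proof
    assume "card ?K = 1"
    then obtain x where x: "?K = {x}" by (rule card_1_singletonE)
    have "0\<^sub>v n = x" using K0 unfolding x by (rule singletonD)
    with x show "?K = {0\<^sub>v n}" by (simp only:)
  qed (simp only: card_1_singleton_iff is_singletonI card.insert card.empty finite.emptyI empty_iff simp_thms if_False One_nat_def)
  also have "\<dots> \<longleftrightarrow> (\<forall>w\<in>carrier_vec n. (\<forall>c<nc. w \<bullet> col A c = 0) \<longrightarrow> w = 0\<^sub>v n)"
    using K0 by blast
  finally show ?thesis unfolding rank_eq_n_iff_span[OF A] .
qed

section \<open>The rows of the matrix as a list of labels\<close>

definition block_rows :: "nat \<Rightarrow> (nat \<Rightarrow> nat) \<Rightarrow> (nat \<times> nat) list" where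
  "block_rows m s = concat (map (\<lambda>i. map (Pair i) [1..<s i + 1]) [1..<m + 1])"

lemma set_block_rows: "set (block_rows m s) = (SIGMA i:{1..m}. {1..s i})"
  by (auto simp: block_rows_def image_iff atLeastLessThanSuc_atLeastAtMost simp del: upt_Suc)

lemma length_block_rows: "length (block_rows m s) = (\<Sum>i = 1..m. s i)"
  by (simp add: block_rows_def length_concat comp_def interv_sum_list_conv_sum_set_nat atLeastLessThanSuc_atLeastAtMost del: upt_Suc)

lemma distinct_block_rows: "distinct (block_rows m s)"
  by (rule card_distinct) (simp add: set_block_rows length_block_rows)

lemma sum_block_rows:
  "(\<Sum>t < (\<Sum>i = 1..m. s i). g (block_rows m s ! t)) = (\<Sum>i = 1..m. \<Sum>r = 1..s i. g (i, r))"
proof -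
  have "(\<Sum>t < length (block_rows m s). g (block_rows m s ! t)) = sum_list (map g (block_rows m s))"
    by (simp add: sum_list_sum_nth atLeast0LessThan)
  also have "\<dots> = (\<Sum>x\<in>set (block_rows m s). g x)"
    by (rule sum_list_distinct_conv_sum_set[OF distinct_block_rows])
  also have "\<dots> = (\<Sum>i = 1..m. \<Sum>r = 1..s i. g (i, r))"
    by (simp add: set_block_rows sum.Sigma)
  finally show ?thesis by (simp add: length_block_rows)
qed

lemma persymmetric_mat_block_rows:
  "persymmetric_mat m s k \<alpha> = mat_of_rows k (map (\<lambda>(i, r). vec k (\<lambda>c. \<alpha> i (r + c))) (block_rows m s))"
  by (simp add: persymmetric_mat_def block_rows_def map_concat comp_def del: upt_Suc)

text \<open>Left kernel vectors correspond to tuples: the entry at the position of label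
  \<open>(i, r)\<close> becomes the coefficient of \<open>x ^ (r - 1)\<close> in component
  \<open>i\<close>.\<close>

lemma persymmetric_mat_full_rank_iff:
  assumes \<delta>: "\<delta> = (\<Sum>i = 1..m. s i)"
  shows "vec_space.rank \<delta> (persymmetric_mat m s k \<alpha>) = \<delta> \<longleftrightarrow>
         (\<forall>p\<in>block_polys {1..m} s - {0}. \<not> left_annihilates m s k p \<alpha>)"
proof -
  let ?M = "persymmetric_mat m s k \<alpha>" and ?L = "block_rows m s"
  have M: "?M \<in> carrier_mat \<delta> k"
    unfolding persymmetric_mat_block_rows \<delta> length_block_rows[symmetric] by (metis length_map mat_of_rows_carrier(1))
  \<comment> \<open>The weights \<open>\<omega>\<close> are indexed by labels instead of positions,
    so that one computation serves both directions.\<close>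
  have prod: "w \<bullet> col ?M c = (\<Sum>i = 1..m. \<Sum>r = 1..s i. \<omega> (i, r) * \<alpha> i (r + c))"
    if "w \<in> carrier_vec \<delta>" "c < k" "\<And>t. t < \<delta> \<Longrightarrow> w $ t = \<omega> (?L ! t)" for w c \<omega>
  proof -
    have "w \<bullet> col ?M c = (\<Sum>t<\<delta>. w $ t * ?M $$ (t, c))"
      using M that(1,2) by (simp add: scalar_prod_def atLeast0LessThan)
    also have "\<dots> = (\<Sum>t<\<delta>. (\<lambda>x. \<omega> x * \<alpha> (fst x) (snd x + c)) (?L ! t))"
      using that length_block_rows[of m s]
      by (intro sum.cong) (auto simp: persymmetric_mat_block_rows mat_of_rows_def \<delta> split: prod.splits)
    also have "\<dots> = (\<Sum>i = 1..m. \<Sum>r = 1..s i. \<omega> (i, r) * \<alpha> i (r + c))"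
      unfolding \<delta> sum_block_rows[where g = "\<lambda>x. \<omega> x * \<alpha> (fst x) (snd x + c)"] fst_conv snd_conv ..
    finally show ?thesis .
  qed
  have nz: "p = 0"
    if p: "p \<in> block_polys {1..m} s" and z: "\<And>i r. i \<in> {1..m} \<Longrightarrow> r \<in> {1..s i} \<Longrightarrow> coeff (coeff p i) (r - 1) = 0" for p
  proof (intro poly_eqI)
    fix i j
    consider "i \<notin> {1..m}" | "i \<in> {1..m}" "j \<ge> s i" | "i \<in> {1..m}" "j + 1 \<in> {1..s i}" by fastforce
    thus "coeff (coeff p i) j = coeff (coeff 0 i) j"
      by cases (use block_polysD[OF p, of i] z[of i "j + 1"] in \<open>auto simp: polys_below_def\<close>)
  qed
  show ?thesis
    unfolding full_row_rank_iff[OF M]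
  proof safe
    fix p assume *: "\<forall>w\<in>carrier_vec \<delta>. (\<forall>c<k. w \<bullet> col ?M c = 0) \<longrightarrow> w = 0\<^sub>v \<delta>"
      and p: "p \<in> block_polys {1..m} s" "p \<noteq> 0" "left_annihilates m s k p \<alpha>"
    define \<omega> where "\<omega> = (\<lambda>(i, r). coeff (coeff p i) (r - 1))"
    define w where "w = vec \<delta> (\<lambda>t. \<omega> (?L ! t))"
    have "w \<bullet> col ?M c = 0" if "c < k" for c
      using prod[of w c \<omega>] that p(3) by (simp add: w_def left_annihilates_def \<omega>_def)
    hence "w = 0\<^sub>v \<delta>" using * by (simp add: w_def)
    hence "\<omega> (?L ! t) = 0" if "t < \<delta>" for t
      using that by (metis w_def index_vec index_zero_vec(1))
    hence "\<omega> x = 0" if "x \<in> set ?L" for x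
      using that by (auto simp: in_set_conv_nth length_block_rows \<delta>)
    hence "coeff (coeff p i) (r - 1) = 0" if "i \<in> {1..m}" "r \<in> {1..s i}" for i r
      using that by (force simp: set_block_rows \<omega>_def)
    with nz p show False by blast
  next
    fix w assume *: "\<forall>p\<in>block_polys {1..m} s - {0}. \<not> left_annihilates m s k p \<alpha>"
      and w: "w \<in> carrier_vec \<delta>" "\<forall>c<k. w \<bullet> col ?M c = 0"
    \<comment> \<open>The labels are distinct, so each label determines its position and hence an
      entry of \<open>w\<close>.\<close>
    define \<omega> where "\<omega> x = w $ inv_into {..<\<delta>} ((!) ?L) x" for x
    have \<omega>: "w $ t = \<omega> (?L ! t)" if "t < \<delta>" for t
      using inv_into_f_f[of "(!) ?L" "{..<\<delta>}" t] that inj_on_nth[OF distinct_block_rows, of "{..<\<delta>}" m s]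
      by (simp add: \<omega>_def length_block_rows \<delta>)
    define q where "q i = (\<Sum>r = 1..s i. monom (\<omega> (i, r)) (r - 1))" for i
    define p where "p = (\<Sum>i = 1..m. monom (q i) i)"
    have coeff_q: "coeff (q i) j = (if j < s i then \<omega> (i, j + 1) else 0)" for i j
    proof -
      have "coeff (q i) j = (\<Sum>r\<in>{1..s i}. if r = j + 1 then \<omega> (i, r) else 0)"
        unfolding q_def coeff_sum by (rule sum.cong) auto
      also have "\<dots> = (if j + 1 \<in> {1..s i} then \<omega> (i, j + 1) else 0)"
        by (rule sum.delta) simp
      finally show ?thesis by simp
    qed
    have coeff_p: "coeff p i = (if i \<in> {1..m} then q i else 0)" for i
      by (simp add: p_def coeff_sum)
    have p: "p \<in> block_polys {1..m} s"
      by (auto simp: block_polys_def coeff_p polys_below_def coeff_q)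
    have pc: "coeff (coeff p i) (r - 1) = \<omega> (i, r)" if "i \<in> {1..m}" "r \<in> {1..s i}" for i r
      using that by (auto simp: coeff_p coeff_q)
    have "left_annihilates m s k p \<alpha>"
      unfolding left_annihilates_def
    proof (intro allI impI)
      fix c assume "c < k"
      have "(\<Sum>i = 1..m. \<Sum>r = 1..s i. coeff (coeff p i) (r - 1) * \<alpha> i (r + c)) =
            (\<Sum>i = 1..m. \<Sum>r = 1..s i. \<omega> (i, r) * \<alpha> i (r + c))"
        by (intro sum.cong refl) (simp only: pc)
      thus "(\<Sum>i = 1..m. \<Sum>r = 1..s i. coeff (coeff p i) (r - 1) * \<alpha> i (r + c)) = 0"
        using prod[OF w(1) \<open>c < k\<close> \<omega>] w(2) \<open>c < k\<close> by simp
    qed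
    hence "p = 0" using * p by blast
    hence "\<omega> (i, r) = 0" if "i \<in> {1..m}" "r \<in> {1..s i}" for i r
      using pc[OF that] by simp
    hence "\<omega> x = 0" if "x \<in> set ?L" for x
      using that by (auto simp: set_block_rows)
    hence "w $ t = 0" if "t < \<delta>" for t
      using \<omega>[OF that] nth_mem[of t ?L] that by (simp add: length_block_rows \<delta>)
    thus "w = 0\<^sub>v \<delta>" using w(1) by (intro eq_vecI) auto
  qed
qed

text \<open>Pigeonhole: \<open>2 ^ (\<Sum>i = 1..m. s i)\<close> tuples meet only
  \<open>2 ^ k\<close> vectors of column values, and the difference of two tuples with equal values
  is a nonzero relation.\<close>

lemma exists_left_annihilating:
  assumes "k < (\<Sum>i = 1..m. s i)"
  shows "\<exists>p\<in>block_polys {1..m} s - {0}. left_annihilates m s k p \<alpha>"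
proof -
  define T where "T p c = (\<Sum>i = 1..m. \<Sum>r = 1..s i. coeff (coeff p i) (r - 1) * \<alpha> i (r + c))" for p :: "bit poly poly" and c
  have T_diff: "T (p - q) c = T p c - T q c" for p q c
    by (simp only: T_def coeff_diff left_diff_distrib sum_subtractf)
  let ?F = "\<lambda>p. restrict (T p) {..<k}"
  have "card ({..<k} \<rightarrow>\<^sub>E (UNIV :: bit set)) < card (block_polys {1..m} s)"
    using assms by (simp add: card_PiE card_UNIV_bit card_block_polys)
  moreover have "?F ` block_polys {1..m} s \<subseteq> {..<k} \<rightarrow>\<^sub>E UNIV" by (intro image_subsetI) simp
  ultimately have "\<not> inj_on ?F (block_polys {1..m} s)"
    by (meson card_inj_on_le finite_PiE finite_lessThan finite_UNIV_bit not_less)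
  then obtain p q where pq: "p \<in> block_polys {1..m} s" "q \<in> block_polys {1..m} s" "?F p = ?F q" "p \<noteq> q"
    by (auto simp: inj_on_def)
  have "T (p - q) c = 0" if "c < k" for c
    using fun_cong[OF pq(3), of c] that unfolding T_diff by (simp add: bit_add_self)
  hence "left_annihilates m s k (p - q) \<alpha>" by (simp add: left_annihilates_def T_def)
  moreover have "p - q \<in> block_polys {1..m} s - {0}" using pq by simp
  ultimately show ?thesis by blast
qed

section \<open>The count for arbitrary positive block sizes\<close>

theorem card_full_rank_persymmetric:
  assumes s: "\<And>i. i \<in> {1..m} \<Longrightarrow> 1 \<le> s i" and \<delta>: "\<delta> = (\<Sum>i = 1..m. s i)" and k: "\<delta> \<le> k"
  shows "int (card {\<alpha> \<in> persymmetric_params m s k. vec_space.rank \<delta> (persymmetric_mat m s k \<alpha>) = \<delta>})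
         = 2 ^ (\<delta> - m) * (\<Prod>j = 1..m. (2 ^ k - 2 ^ (\<delta> - j)))"
proof -
  let ?B = "block_polys {1..m} s - {0}"
  define D where "D = (\<Sum>i = 1..m. s i - 1)"
  have "\<delta> = (\<Sum>i = 1..m. (s i - 1) + 1)" unfolding \<delta> using s by (intro sum.cong refl) (metis le_add_diff_inverse2)
  hence \<delta>D: "\<delta> = D + m" by (simp add: D_def sum.distrib del: add_Suc_right)
  obtain Q :: "int poly" where Q: "degree Q \<le> m" "coeff Q m = 2 ^ D"
    "\<And>k. k \<ge> D \<Longrightarrow> int (annihilated_count m s {} ?B k) = poly Q (2 ^ k)"
    using annihilated_count_polynomial[of m s ?B "{}"] s card_block_polys(2)[of "{1..m}" s] unfolding D_def by auto
  \<comment> \<open>The exponents \<open>\<delta> - j\<close> run through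
    \<open>D, \<dots>, \<delta> - 1\<close>: large enough for the polynomial formula to hold, but
    too small a number of columns for full row rank.\<close>
  define R :: "int set" where "R = (\<lambda>j. 2 ^ (\<delta> - j)) ` {1..m}"
  have inj: "inj_on (\<lambda>j. 2 ^ (\<delta> - j) :: int) {1..m}"
    by (rule inj_onI) (auto simp: \<delta>D)
  have cardR: "card R = m" unfolding R_def card_image[OF inj] by simp
  have "poly Q x = 0" if "x \<in> R" for x
  proof -
    from that obtain j where j: "j \<in> {1..m}" "x = 2 ^ (\<delta> - j)" by (auto simp: R_def)
    hence "\<delta> - j < \<delta>" "\<delta> - j \<ge> D" by (auto simp: \<delta>D)
    hence "annihilated_count m s {} ?B (\<delta> - j) = 0"
      using exists_left_annihilating[of "\<delta> - j" s m, folded \<delta>]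
      by (auto simp: annihilated_count_def card_eq_0_iff)
    thus ?thesis using Q(3)[OF \<open>\<delta> - j \<ge> D\<close>] j(2) by simp
  qed
  moreover have "finite R" by (simp add: R_def)
  ultimately have "Q = smult (2 ^ D) (\<Prod>x\<in>R. [:- x, 1:])"
    using poly_eq_prod_of_roots[of Q R, unfolded cardR, OF Q(1)] unfolding Q(2) by blast
  hence "poly Q (2 ^ k) = 2 ^ D * (\<Prod>x\<in>R. 2 ^ k - x)"
    by (simp add: poly_prod)
  also have "(\<Prod>x\<in>R. 2 ^ k - x) = (\<Prod>j = 1..m. 2 ^ k - 2 ^ (\<delta> - j))"
    unfolding R_def prod.reindex[OF inj] comp_def ..
  finally show ?thesis
    using Q(3)[of k] k unfolding persymmetric_mat_full_rank_iff[OF \<delta>]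
    by (simp add: annihilated_count_def \<delta>D)
qed

theorem theorem7p1:
  fixes m k \<delta> :: nat and s :: "nat \<Rightarrow> nat"
  assumes "m \<ge> 4" and "k > 0"
    and "2 \<le> s (m - 2)" and "s (m - 2) \<le> s (m - 1)" and "s (m - 1) \<le> s m"
    and "\<forall>i\<in>{1..m - 3}. s i = 1"
    and "\<delta> = (\<Sum>j = 1..m. s j)"
    and "\<delta> \<le> k"
  shows "int (card {\<alpha> \<in> persymmetric_params m s k.
             vec_space.rank \<delta> (persymmetric_mat m s k \<alpha>) = \<delta>})
         = 2 ^ (\<delta> - m) * (\<Prod>j = 1..m. (2 ^ k - 2 ^ (\<delta> - j)))"
proof (rule card_full_rank_persymmetric)
  fix i assume "i \<in> {1..m}"
  hence "i \<in> {1..m - 3} \<or> i = m - 2 \<or> i = m - 1 \<or> i = m" by auto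
  thus "1 \<le> s i" using assms by auto
qed (use assms in auto)

end
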